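(* For every positive integer $n$, $$\sum_{\sigma\in B_n}\prod_{i\in\overleftarrow{\mathrm{Min}}_0(\sigma)}x_i\cdot\prod_{i\in\overleftarrow{\mathrm{Min}}_1(\sigma)}t_i\cdot q^{\mathrm{fmaj}(\sigma)}=\prod_{j=1}^n\bigl(x_j+q+q^2+\cdots+q^{2j-2}+q^{2j-1}t_j\bigr).$$
   Context: $B_n=C_2\wr S_n$ is the group of signed permutations $\sigma=[\sigma(1),\dots,\sigma(n)]$ of $\{\pm1,\dots,\pm n\}$ with $\sigma(-j)=-\sigma(j)$; $|\sigma|=[|\sigma(1)|,\dots,|\sigma(n)|]\in S_n$; set $\sigma(0)=0$. $\overleftarrow{\mathrm{Min}}_0(\sigma)$ (resp. $\overleftarrow{\mathrm{Min}}_1(\sigma)$) is the set of values $|\sigma(i)|$ which are right-to-left minima of $|\sigma|$ (i.e. $|\sigma(i)|<|\sigma(j)|$ for all $j>i$) with $\sigma(i)>0$ (resp. $\sigma(i)<0$). Let $Des_A(\sigma)=\{0\le i\le n-1:\sigma(i)>\sigma(i+1)\}$ (usual order on integers), $maj_A(\sigma)=\sum_{i\in Des_A(\sigma)}i$, $neg(\sigma)=\#\{i:\sigma(i)<0\}$, and the flag major index $\mathrm{fmaj}(\sigma)=2\,maj_A(\sigma)+neg(\sigma)$. *)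

theory Defs
  imports Complex_Main "HOL-Combinatorics.Permutations"
begin

text \<open>
  A signed permutation is a map on all integers that permutes
  \<open>{-n, \<dots>, -1, 1, \<dots>, n}\<close>, is odd, and is the identity elsewhere, so that each
  element of the group is represented exactly once and the convention \<open>\<sigma> 0 = 0\<close> is built in.
\<close>

definition signed_perms :: "nat \<Rightarrow> (int \<Rightarrow> int) set" where
  "signed_perms n = {\<sigma>. \<sigma> permutes ({- int n..int n} - {0}) \<and> (\<forall>j. \<sigma> (- j) = - \<sigma> j)}"

definition abs_perm :: "(int \<Rightarrow> int) \<Rightarrow> nat \<Rightarrow> nat" where
  "abs_perm \<sigma> i = nat \<bar>\<sigma> (int i)\<bar>"

definition rl_min_positions :: "nat \<Rightarrow> (nat \<Rightarrow> nat) \<Rightarrow> nat set" where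
  "rl_min_positions n \<pi> = {i \<in> {1..n}. \<forall>j \<in> {i<..n}. \<pi> i < \<pi> j}"

text \<open>The sets of right-to-left minima consist of values of \<open>abs_perm \<sigma>\<close>, not of positions.\<close>

definition Min0 :: "nat \<Rightarrow> (int \<Rightarrow> int) \<Rightarrow> nat set" where
  "Min0 n \<sigma> = {abs_perm \<sigma> i | i. i \<in> rl_min_positions n (abs_perm \<sigma>) \<and> \<sigma> (int i) > 0}"

definition Min1 :: "nat \<Rightarrow> (int \<Rightarrow> int) \<Rightarrow> nat set" where
  "Min1 n \<sigma> = {abs_perm \<sigma> i | i. i \<in> rl_min_positions n (abs_perm \<sigma>) \<and> \<sigma> (int i) < 0}"

definition Des_A :: "nat \<Rightarrow> (int \<Rightarrow> int) \<Rightarrow> nat set" where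
  "Des_A n \<sigma> = {i \<in> {0..<n}. \<sigma> (int i) > \<sigma> (int (i + 1))}"

definition maj_A :: "nat \<Rightarrow> (int \<Rightarrow> int) \<Rightarrow> nat" where
  "maj_A n \<sigma> = (\<Sum>i\<in>Des_A n \<sigma>. i)"

definition neg :: "nat \<Rightarrow> (int \<Rightarrow> int) \<Rightarrow> nat" where
  "neg n \<sigma> = card {i \<in> {1..n}. \<sigma> (int i) < 0}"

definition fmaj :: "nat \<Rightarrow> (int \<Rightarrow> int) \<Rightarrow> nat" where
  "fmaj n \<sigma> = 2 * maj_A n \<sigma> + neg n \<sigma>"

end

(* Writing signed permutations as words, each word on {1..n+1} arises from a unique word w on {1..n}
   by inserting N = n+1 or -N into one of the n+1 gaps.  Insertion does not affect the smaller
   right-to-left minima, and N itself is one exactly when it is inserted at the end, which changes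
   fmaj by 0 (for N) or by 2n+1 (for -N).  Over the other gaps the increments of maj run, in some
   order, through 1, ..., n for N and through 0, ..., n-1 for -N, so the increments of fmaj run
   through 1, ..., 2n.  Each insertion step therefore multiplies the sum by one factor. *)

theory Submission
  imports Defs
begin

section \<open>Words and their statistics\<close>

text \<open>One-line notations of signed permutations: \<open>n\<close> letters must account for
  \<open>n\<close> absolute values, so each absolute value occurs exactly once.\<close>

definition signed_words :: "nat \<Rightarrow> int list set" where
  "signed_words n = {w. length w = n \<and> (\<lambda>v. nat \<bar>v\<bar>) ` set w = {1..n}}"

text \<open>The prepended 0 plays the part of the value at 0, so list index \<open>i\<close>
  compares the letters in positions \<open>i\<close> and \<open>i + 1\<close> and a descent there
  weighs \<open>i\<close>.\<close>

definition word_maj :: "int list \<Rightarrow> nat" where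
  "word_maj w = (\<Sum>i<length w. if (0 # w) ! i > w ! i then i else 0)"

definition word_fmaj :: "int list \<Rightarrow> nat" where
  "word_fmaj w = 2 * word_maj w + length (filter (\<lambda>v. v < 0) w)"

definition letter_weight :: "(nat \<Rightarrow> 'a) \<Rightarrow> (nat \<Rightarrow> 'a) \<Rightarrow> int \<Rightarrow> 'a" where
  "letter_weight x t v = (if v > 0 then x (nat \<bar>v\<bar>) else t (nat \<bar>v\<bar>))"

text \<open>Running over positions rather than over sets of values makes a recursion on the list
  available; distinctness of the absolute values keeps the two products equal for signed
  permutations.\<close>

definition min_weight :: "(nat \<Rightarrow> 'a) \<Rightarrow> (nat \<Rightarrow> 'a) \<Rightarrow> int list \<Rightarrow> 'a::comm_ring_1" where
  "min_weight x t w = (\<Prod>i<length w.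
     if \<forall>b\<in>set (drop (Suc i) w). \<bar>w ! i\<bar> < \<bar>b\<bar> then letter_weight x t (w ! i) else 1)"

definition insert_at :: "nat \<Rightarrow> 'b \<Rightarrow> 'b list \<Rightarrow> 'b list" where
  "insert_at p v w = take p w @ v # drop p w"

lemma length_insert_at [simp]: "length (insert_at p v w) = Suc (length w)"
  by (simp add: insert_at_def)

lemma set_insert_at [simp]: "set (insert_at p v w) = insert v (set w)"
  by (metis append_take_drop_id insert_at_def list.simps(15) set_append Un_insert_right)

lemma insert_at_length [simp]: "insert_at (length w) v w = w @ [v]"
  by (simp add: insert_at_def)

lemma insert_at_snoc: "p \<le> length w \<Longrightarrow> insert_at p v (w @ [a]) = insert_at p v w @ [a]"
  by (simp add: insert_at_def)

text \<open>Away from the last gap, an insertion cannot affect whether a letter appended later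
  creates a descent.\<close>

lemma last_insert_at: "p < length w \<Longrightarrow> last (b # insert_at p v w) = last (b # w)"
  by (auto simp: insert_at_def)

lemma length_filter_insert_at:
  "length (filter P (insert_at p v w)) = length (filter P w) + (if P v then 1 else 0)"
proof -
  have "length (filter P w) = length (filter P (take p w)) + length (filter P (drop p w))"
    by (metis append_take_drop_id filter_append length_append)
  then show ?thesis
    by (simp add: insert_at_def)
qed

lemma abs_last_less:
  fixes N :: int
  assumes "\<forall>b\<in>set w. \<bar>b\<bar> < N" "N > 0"
  shows "\<bar>last (0 # w)\<bar> < N"
  using last_in_set[of "0 # w"] assms by auto

lemma word_maj_Nil [simp]: "word_maj [] = 0"
  by (simp add: word_maj_def)

text \<open>Appending on the right leaves the earlier descent positions alone, hence the inductions
  from the right end for the major index.\<close>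

lemma word_maj_snoc:
  "word_maj (w @ [a]) = word_maj w + (if last (0 # w) > a then length w else 0)"
proof -
  have "(0 # w @ [a]) ! i = (0 # w) ! i" if "i \<le> length w" for i
    using that by (metis append_Cons le_imp_less_Suc length_Cons nth_append)
  moreover have "last (0 # w) = (0 # w) ! length w"
    by (simp add: last_conv_nth)
  ultimately show ?thesis
    by (simp add: word_maj_def nth_append)
qed

lemma min_weight_Nil [simp]: "min_weight x t [] = 1"
  by (simp add: min_weight_def)

text \<open>Being a right-to-left minimum depends only on the letters to the right, so this
  statistic is peeled off from the left.\<close>

lemma min_weight_Cons:
  "min_weight x t (a # w) =
     (if \<forall>b\<in>set w. \<bar>a\<bar> < \<bar>b\<bar> then letter_weight x t a else 1) * min_weight x t w"
  unfolding min_weight_def length_Cons prod.lessThan_Suc_shift by (simp cong: if_cong)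

section \<open>The effect of inserting a letter of maximal absolute value\<close>

text \<open>A letter of larger absolute value never spoils the minimality of a letter before it, and
  is itself minimal only when nothing follows it.\<close>

lemma min_weight_insert_at:
  assumes "p \<le> length w" "\<forall>b\<in>set w. \<bar>b\<bar> < \<bar>v\<bar>"
  shows "min_weight x t (insert_at p v w) =
    (if p = length w then letter_weight x t v else 1) * min_weight x t w"
  using assms
proof (induction w arbitrary: p)
  case Nil
  then show ?case by (simp add: insert_at_def min_weight_Cons)
next
  case (Cons a w)
  show ?case
  proof (cases p)
    case 0
    have "insert_at 0 v (a # w) = v # a # w"
      by (simp add: insert_at_def)
    with 0 Cons.prems show ?thesis
      by (auto simp: min_weight_Cons)
  next
    case (Suc p')
    have "insert_at p v (a # w) = a # insert_at p' v w"
      by (simp add: insert_at_def Suc)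
    with Suc Cons show ?thesis
      by (simp add: min_weight_Cons mult_ac)
  qed
qed

text \<open>These two sums are stated for an arbitrary summand because the induction needs to shift
  its argument: a final descent raises every earlier increment by one.\<close>

lemma sum_word_maj_insert_pos:
  fixes f :: "nat \<Rightarrow> 'a::comm_monoid_add"
  assumes "\<forall>b\<in>set w. \<bar>b\<bar> < N" "N > 0"
  shows "(\<Sum>p<length w. f (word_maj (insert_at p N w))) = (\<Sum>p<length w. f (word_maj w + p + 1))"
  using assms(1)
proof (induction w arbitrary: f rule: rev_induct)
  case (snoc a w)
  let ?m = "length w" and ?d = "last (0 # w) > a"
  have "last (0 # w) < N" "a < N"
    using snoc.prems abs_last_less[of w N] assms(2) by auto
  \<comment> \<open>The word is now \<open>w\<close>, \<open>N\<close>, \<open>a\<close>: there is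
    an ascent into \<open>N\<close>, and the only new descent compared with \<open>w\<close> is at
    position \<open>?m + 1\<close>, whatever \<open>?d\<close> is.\<close>
  then have last_gap: "word_maj (insert_at ?m N (w @ [a])) = word_maj w + ?m + 1"
    using word_maj_snoc[of "w @ [N]" a] word_maj_snoc[of w "N"]
    by (simp add: insert_at_snoc del: last.simps) simp
  \<comment> \<open>Inserting further left pushes \<open>a\<close> one place to the right, so a
    descent into \<open>a\<close> weighs \<open>?m + 1\<close> instead of \<open>?m\<close>.\<close>
  have "word_maj (insert_at p N (w @ [a])) = word_maj (insert_at p N w) + (if ?d then ?m + 1 else 0)"
    if "p < ?m" for p
    using that last_insert_at[OF that, of 0 N]
    by (simp add: insert_at_snoc word_maj_snoc del: last.simps)
  then have "(\<Sum>p<?m. f (word_maj (insert_at p N (w @ [a]))))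
      = (\<Sum>p<?m. f (word_maj (insert_at p N w) + (if ?d then ?m + 1 else 0)))"
    by simp
  also have "\<dots> = (\<Sum>p<?m. f (word_maj w + p + 1 + (if ?d then ?m + 1 else 0)))"
    using snoc by (intro snoc.IH) auto
  finally have "(\<Sum>p<length (w @ [a]). f (word_maj (insert_at p N (w @ [a]))))
      = (\<Sum>p<?m. f (word_maj w + p + 1 + (if ?d then ?m + 1 else 0))) + f (word_maj w + ?m + 1)"
    using last_gap by simp
  also have "\<dots> = (\<Sum>p<Suc ?m. f (word_maj (w @ [a]) + p + 1))"
  \<comment> \<open>With a final descent, the base value already contains \<open>?m\<close>, so the
    last gap gives the smallest increment and the other terms shift up by one index; without it, the
    last gap gives the largest increment.\<close>
  proof (cases ?d)
    case True
    then show ?thesis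
      unfolding sum.lessThan_Suc_shift by (simp add: word_maj_snoc add_ac)
  qed (simp add: word_maj_snoc)
  finally show ?case by simp
qed simp

lemma sum_word_maj_insert_neg:
  fixes f :: "nat \<Rightarrow> 'a::comm_monoid_add"
  assumes "\<forall>b\<in>set w. \<bar>b\<bar> < N" "N > 0"
  shows "(\<Sum>p<length w. f (word_maj (insert_at p (- N) w))) = (\<Sum>p<length w. f (word_maj w + p))"
  using assms(1)
proof (induction w arbitrary: f rule: rev_induct)
  case (snoc a w)
  let ?m = "length w" and ?d = "last (0 # w) > a"
  have "\<bar>last (0 # w)\<bar> < N" "\<bar>a\<bar> < N"
    using snoc.prems abs_last_less[of w N] assms(2) by auto
  then have "- N < last (0 # w)" "- N < a"
    by linarith+
  \<comment> \<open>Here the descent is the one into \<open>- N\<close>, at position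
    \<open>?m\<close>, and \<open>a\<close> follows by an ascent; this lowers all increments by one
    compared with \<open>N\<close>.\<close>
  then have last_gap: "word_maj (insert_at ?m (- N) (w @ [a])) = word_maj w + ?m"
    using word_maj_snoc[of "w @ [- N]" a] word_maj_snoc[of w "- N"]
    by (simp add: insert_at_snoc del: last.simps) simp
  have "word_maj (insert_at p (- N) (w @ [a])) = word_maj (insert_at p (- N) w) + (if ?d then ?m + 1 else 0)"
    if "p < ?m" for p
    using that last_insert_at[OF that, of 0 "- N"]
    by (simp add: insert_at_snoc word_maj_snoc del: last.simps)
  then have "(\<Sum>p<?m. f (word_maj (insert_at p (- N) (w @ [a]))))
      = (\<Sum>p<?m. f (word_maj (insert_at p (- N) w) + (if ?d then ?m + 1 else 0)))"
    by simp
  also have "\<dots> = (\<Sum>p<?m. f (word_maj w + p + (if ?d then ?m + 1 else 0)))"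
    using snoc by (intro snoc.IH) auto
  finally have "(\<Sum>p<length (w @ [a]). f (word_maj (insert_at p (- N) (w @ [a]))))
      = (\<Sum>p<?m. f (word_maj w + p + (if ?d then ?m + 1 else 0))) + f (word_maj w + ?m)"
    using last_gap by simp
  also have "\<dots> = (\<Sum>p<Suc ?m. f (word_maj (w @ [a]) + p))"
  proof (cases ?d)
    case True
    then show ?thesis
      unfolding sum.lessThan_Suc_shift by (simp add: word_maj_snoc add_ac)
  qed (simp add: word_maj_snoc)
  finally show ?case by simp
qed simp

text \<open>The even exponents come from inserting \<open>N\<close> and the odd ones from
  \<open>- N\<close>, whose sign adds 1 to twice the major index; together they leave no
  gap.\<close>

lemma sum_powers_pairs:
  fixes q :: "'a::comm_semiring_1"
  shows "(\<Sum>p<m. q ^ (2 * p + 2) + q ^ (2 * p + 1)) = (\<Sum>k=1..2*m. q ^ k)"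
  by (induction m) (simp_all add: add_ac)

text \<open>The factor depends on \<open>w\<close> only through its length. This is what allows it
  to be pulled out of the sum over all words of that length.\<close>

lemma sum_weight_insert_at:
  fixes x t :: "nat \<Rightarrow> 'a::comm_ring_1" and q :: 'a
  assumes "\<forall>b\<in>set w. \<bar>b\<bar> < int (Suc (length w))"
  defines "F \<equiv> \<lambda>w. min_weight x t w * q ^ word_fmaj w"
  shows "(\<Sum>p\<le>length w. \<Sum>v\<in>{int (Suc (length w)), - int (Suc (length w))}. F (insert_at p v w))
    = F w * (x (Suc (length w)) + (\<Sum>k=1..2 * length w. q ^ k)
        + q ^ (2 * length w + 1) * t (Suc (length w)))"
proof -
  let ?m = "length w"
  define N where "N = int (Suc ?m)"
  define c where "c = length (filter (\<lambda>v. v < 0) w)"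
  have N: "N > 0" "\<forall>b\<in>set w. \<bar>b\<bar> < N"
    using assms(1) by (auto simp: N_def)
  have "\<bar>last (0 # w)\<bar> < N"
    using N by (intro abs_last_less) auto
  then have last_N: "last (0 # w) < N" "- N < last (0 # w)"
    by linarith+
  have fmaj_pos: "word_fmaj (insert_at p N w) = 2 * word_maj (insert_at p N w) + c"
    and fmaj_neg: "word_fmaj (insert_at p (- N) w) = 2 * word_maj (insert_at p (- N) w) + c + 1" for p
    using N(1) by (simp_all add: word_fmaj_def length_filter_insert_at c_def)
  have fmaj: "word_fmaj w = 2 * word_maj w + c"
    by (simp add: word_fmaj_def c_def)
  have min_w: "min_weight x t (insert_at p v w) = min_weight x t w"
    if "p < ?m" "v \<in> {N, - N}" for p v
    using that N by (subst min_weight_insert_at) auto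
  have min_N: "min_weight x t (w @ [N]) = x (Suc ?m) * min_weight x t w"
    using N min_weight_insert_at[of ?m w N x t]
    by (simp add: letter_weight_def) (simp add: N_def nat_add_distrib)
  have min_neg_N: "min_weight x t (w @ [- N]) = t (Suc ?m) * min_weight x t w"
    using N min_weight_insert_at[of ?m w "- N" x t]
    by (simp add: letter_weight_def) (simp add: N_def nat_add_distrib)
  have last_pos: "F (insert_at ?m N w) = F w * x (Suc ?m)"
    using last_N min_N
    unfolding F_def fmaj_pos fmaj
    by (simp add: word_maj_snoc mult_ac del: last.simps)
  \<comment> \<open>Appending \<open>- N\<close> creates a descent at \<open>?m\<close>, counted
    twice, and one negative letter, which gives the exponent \<open>2 * ?m + 1\<close>.\<close>
  have last_neg: "F (insert_at ?m (- N) w) = F w * (q ^ (2 * ?m + 1) * t (Suc ?m))"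
    using last_N min_neg_N
    unfolding F_def fmaj_neg fmaj
    by (simp add: word_maj_snoc power_add mult_ac del: last.simps)
  have "(\<Sum>p<?m. F (insert_at p N w))
      = min_weight x t w * (\<Sum>p<?m. q ^ (2 * word_maj (insert_at p N w) + c))"
    unfolding F_def fmaj_pos sum_distrib_left using min_w by (intro sum.cong) auto
  also have "\<dots> = min_weight x t w * (\<Sum>p<?m. q ^ (2 * (word_maj w + p + 1) + c))"
    using sum_word_maj_insert_pos[OF N(2,1), of "\<lambda>k. q ^ (2 * k + c)"] by simp
  also have "\<dots> = F w * (\<Sum>p<?m. q ^ (2 * p + 2))"
    unfolding F_def fmaj sum_distrib_left
    by (intro sum.cong) (simp_all add: power_add mult_ac power2_eq_square)
  finally have pos: "(\<Sum>p<?m. F (insert_at p N w)) = F w * (\<Sum>p<?m. q ^ (2 * p + 2))" .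
  have "(\<Sum>p<?m. F (insert_at p (- N) w))
      = min_weight x t w * (\<Sum>p<?m. q ^ (2 * word_maj (insert_at p (- N) w) + c + 1))"
    unfolding F_def fmaj_neg sum_distrib_left using min_w by (intro sum.cong) auto
  also have "\<dots> = min_weight x t w * (\<Sum>p<?m. q ^ (2 * (word_maj w + p) + c + 1))"
    using sum_word_maj_insert_neg[OF N(2,1), of "\<lambda>k. q ^ (2 * k + c + 1)"] by simp
  also have "\<dots> = F w * (\<Sum>p<?m. q ^ (2 * p + 1))"
    unfolding F_def fmaj sum_distrib_left
    by (intro sum.cong) (simp_all add: power_add mult_ac)
  finally have neg: "(\<Sum>p<?m. F (insert_at p (- N) w)) = F w * (\<Sum>p<?m. q ^ (2 * p + 1))" .
  have "N \<noteq> - N"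
    using N(1) by simp
  then have "(\<Sum>p\<le>?m. \<Sum>v\<in>{N, - N}. F (insert_at p v w))
      = (\<Sum>p\<le>?m. F (insert_at p N w)) + (\<Sum>p\<le>?m. F (insert_at p (- N) w))"
    by (simp add: sum.distrib)
  also have "\<dots> = F w * (x (Suc ?m) + (\<Sum>p<?m. q ^ (2 * p + 2) + q ^ (2 * p + 1))
      + q ^ (2 * ?m + 1) * t (Suc ?m))"
    unfolding lessThan_Suc_atMost[symmetric] sum.lessThan_Suc pos neg last_pos last_neg sum.distrib
    by (simp add: distrib_left add_ac)
  finally show ?thesis
    unfolding sum_powers_pairs N_def .
qed

section \<open>Generating all words by insertion\<close>

lemma signed_words_abs_less:
  assumes "w \<in> signed_words n" "b \<in> set w"
  shows "\<bar>b\<bar> < int (Suc n)"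
proof -
  have "nat \<bar>b\<bar> \<in> {1..n}"
    using assms unfolding signed_words_def by blast
  then show ?thesis by auto
qed

lemma distinct_abs_signed_word:
  assumes "w \<in> signed_words n"
  shows "distinct (map (\<lambda>v. nat \<bar>v\<bar>) w)"
  using assms by (intro card_distinct) (simp add: signed_words_def)

text \<open>The inverse deletes the unique letter of absolute value \<open>Suc n\<close> and records
  its gap and sign.\<close>

lemma bij_betw_insert_at:
  fixes n :: nat
  defines "N \<equiv> int (Suc n)"
  shows "bij_betw (\<lambda>(w, p, v). insert_at p v w)
    (signed_words n \<times> {..n} \<times> {N, - N}) (signed_words (Suc n))"
  unfolding bij_betw_def
proof
  let ?other = "\<lambda>b. \<bar>b\<bar> \<noteq> N"
  show "inj_on (\<lambda>(w, p, v). insert_at p v w) (signed_words n \<times> {..n} \<times> {N, - N})"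
  \<comment> \<open>The explicit left inverse: filtering by \<open>?other\<close> recovers
    \<open>w\<close>, the prefix before the first letter of absolute value \<open>N\<close> has
    length \<open>p\<close>, and the letter at that index is \<open>v\<close>.\<close>
  proof (rule inj_on_inverseI)
    fix z assume "z \<in> signed_words n \<times> {..n} \<times> {N, - N}"
    then obtain w p v where z: "z = (w, p, v)" and w: "w \<in> signed_words n" and "p \<le> n"
      and v: "\<bar>v\<bar> = N"
      by (auto simp: N_def)
    have len: "p \<le> length w"
      using w \<open>p \<le> n\<close> by (simp add: signed_words_def)
    have other: "?other b" if "b \<in> set w" for b
      using signed_words_abs_less[OF w that] by (simp add: N_def)
    have "filter ?other (insert_at p v w) = filter ?other (take p w @ drop p w)"
      unfolding insert_at_def filter_append using v by simp
    also have "\<dots> = w"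
      using other by simp
    finally have 1: "filter ?other (insert_at p v w) = w" .
    have "takeWhile ?other (insert_at p v w) = take p w"
      unfolding insert_at_def using v other by (subst takeWhile_append2) (auto dest: in_set_takeD)
    then have 2: "length (takeWhile ?other (insert_at p v w)) = p"
      using len by simp
    have 3: "insert_at p v w ! p = v"
      using len by (simp add: insert_at_def nth_append)
    show "(\<lambda>u. (filter ?other u, length (takeWhile ?other u), u ! length (takeWhile ?other u)))
        ((\<lambda>(w, p, v). insert_at p v w) z) = z"
      using z 1 2 3 by simp
  qed
  show "(\<lambda>(w, p, v). insert_at p v w) ` (signed_words n \<times> {..n} \<times> {N, - N}) = signed_words (Suc n)"
  proof (intro equalityI subsetI)
    fix u assume "u \<in> (\<lambda>(w, p, v). insert_at p v w) ` (signed_words n \<times> {..n} \<times> {N, - N})"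
    then obtain w p v where "u = insert_at p v w" "w \<in> signed_words n" and v: "v \<in> {N, - N}"
      by auto
    moreover have "nat \<bar>v\<bar> = Suc n"
      using v by (auto simp: N_def)
    ultimately show "u \<in> signed_words (Suc n)"
      by (simp add: signed_words_def atLeastAtMostSuc_conv)
  next
    fix u assume u: "u \<in> signed_words (Suc n)"
    then have "Suc n \<in> (\<lambda>v. nat \<bar>v\<bar>) ` set u"
      by (simp add: signed_words_def)
    then obtain v where v: "v \<in> set u" "Suc n = nat \<bar>v\<bar>"
      by auto
    then obtain a b where ab: "u = a @ v # b"
      by (meson split_list)
    \<comment> \<open>Since the largest absolute value occurs only once, removing \<open>v\<close>
      leaves exactly the absolute values \<open>{1..n}\<close>.\<close>
    have "nat \<bar>v\<bar> \<notin> (\<lambda>v. nat \<bar>v\<bar>) ` set (a @ b)"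
      using distinct_abs_signed_word[OF u] unfolding ab by auto
    moreover have "insert (nat \<bar>v\<bar>) ((\<lambda>v. nat \<bar>v\<bar>) ` set (a @ b)) = {1..Suc n}"
      using u unfolding ab signed_words_def by auto
    ultimately have "(\<lambda>v. nat \<bar>v\<bar>) ` set (a @ b) = {1..Suc n} - {Suc n}"
      using v(2) by (metis Diff_insert_absorb)
    also have "\<dots> = {1..n}"
      by auto
    finally have "a @ b \<in> signed_words n"
      using u unfolding ab signed_words_def by simp
    moreover have "length a \<le> n"
      using u unfolding ab signed_words_def by simp
    moreover have "v \<in> {N, - N}"
      using v(2) by (auto simp: N_def)
    moreover have "u = insert_at (length a) v (a @ b)"
      by (simp add: ab insert_at_def)
    ultimately show "u \<in> (\<lambda>(w, p, v). insert_at p v w) ` (signed_words n \<times> {..n} \<times> {N, - N})"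
      by (intro image_eqI[where x = "(a @ b, length a, v)"]) auto
  qed
qed

lemma signed_words_0 [simp]: "signed_words 0 = {[]}"
  by (auto simp: signed_words_def)

lemma sum_signed_words:
  fixes x t :: "nat \<Rightarrow> 'a::comm_ring_1" and q :: 'a
  shows "(\<Sum>w\<in>signed_words n. min_weight x t w * q ^ word_fmaj w)
    = (\<Prod>j=1..n. x j + (\<Sum>k=1..2*j-2. q ^ k) + q ^ (2*j-1) * t j)"
proof (induction n)
  case 0
  show ?case by (simp add: word_fmaj_def)
next
  case (Suc n)
  let ?F = "\<lambda>w. min_weight x t w * q ^ word_fmaj w" and ?N = "int (Suc n)"
  have "(\<Sum>w\<in>signed_words (Suc n). ?F w)
      = (\<Sum>(w, p, v)\<in>signed_words n \<times> {..n} \<times> {?N, - ?N}. ?F (insert_at p v w))"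
    unfolding sum.reindex_bij_betw[OF bij_betw_insert_at[of n], symmetric]
    by (intro sum.cong) auto
  also have "\<dots> = (\<Sum>w\<in>signed_words n. \<Sum>p\<le>n. \<Sum>v\<in>{?N, - ?N}. ?F (insert_at p v w))"
    by (simp only: sum.cartesian_product)
  also have "\<dots> = (\<Sum>w\<in>signed_words n. ?F w *
      (x (Suc n) + (\<Sum>k=1..2*n. q ^ k) + q ^ (2*n+1) * t (Suc n)))"
  proof (rule sum.cong[OF refl])
    fix w assume w: "w \<in> signed_words n"
    then have "length w = n"
      by (simp add: signed_words_def)
    then show "(\<Sum>p\<le>n. \<Sum>v\<in>{?N, - ?N}. ?F (insert_at p v w)) = ?F w *
      (x (Suc n) + (\<Sum>k=1..2*n. q ^ k) + q ^ (2*n+1) * t (Suc n))"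
      using sum_weight_insert_at[of w x t q] signed_words_abs_less[OF w] by blast
  qed
  also have "\<dots> = (\<Prod>j=1..n. x j + (\<Sum>k=1..2*j-2. q ^ k) + q ^ (2*j-1) * t j) *
      (x (Suc n) + (\<Sum>k=1..2*n. q ^ k) + q ^ (2*n+1) * t (Suc n))"
    unfolding sum_distrib_right[symmetric] Suc.IH ..
  \<comment> \<open>The new factor is the one for \<open>j = Suc n\<close>, where
    \<open>2*j-2\<close> and \<open>2*j-1\<close> are \<open>2*n\<close> and
    \<open>2*n+1\<close>.\<close>
  finally show ?case by simp
qed

section \<open>Signed permutations as words\<close>

definition word_of :: "nat \<Rightarrow> (int \<Rightarrow> int) \<Rightarrow> int list" where
  "word_of n \<sigma> = map (\<lambda>i. \<sigma> (int i)) [1..<Suc n]"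

lemma length_word_of [simp]: "length (word_of n \<sigma>) = n"
  by (simp add: word_of_def)

lemma nth_word_of [simp]: "i < n \<Longrightarrow> word_of n \<sigma> ! i = \<sigma> (int (Suc i))"
  by (simp add: word_of_def nth_append del: upt_Suc)

text \<open>By oddness, a negative preimage of \<open>k\<close> can be replaced by its opposite,
  which changes only the sign of the value.\<close>

lemma signed_perms_abs_image:
  assumes "\<sigma> \<in> signed_perms n"
  shows "abs_perm \<sigma> ` {1..n} = {1..n}"
proof (intro equalityI subsetI)
  let ?S = "{- int n..int n} - {0}"
  have perm: "\<sigma> permutes ?S" and odd: "\<sigma> (- j) = - \<sigma> j" for j
    using assms by (auto simp: signed_perms_def)
  {
    fix k assume "k \<in> abs_perm \<sigma> ` {1..n}"
    then obtain i where i: "i \<in> {1..n}" "k = nat \<bar>\<sigma> (int i)\<bar>"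
      by (auto simp: abs_perm_def)
    then have "\<sigma> (int i) \<in> ?S"
      using permutes_in_image[OF perm, of "int i"] by auto
    with i show "k \<in> {1..n}" by auto
  next
    fix k assume "k \<in> {1..n}"
    then have "int k \<in> \<sigma> ` ?S"
      using permutes_image[OF perm] by auto
    then obtain j where j: "j \<in> ?S" "\<sigma> j = int k"
      by (metis imageE)
    have "abs_perm \<sigma> (nat \<bar>j\<bar>) = k"
      using j(2) odd[of j] by (auto simp: abs_perm_def abs_if)
    moreover have "nat \<bar>j\<bar> \<in> {1..n}"
      using j(1) by auto
    ultimately show "k \<in> abs_perm \<sigma> ` {1..n}"
      by blast
  }
qed

lemma inj_on_abs_perm:
  assumes "\<sigma> \<in> signed_perms n"
  shows "inj_on (abs_perm \<sigma>) {1..n}"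
  using signed_perms_abs_image[OF assms] by (intro eq_card_imp_inj_on) auto

text \<open>The values at 1, ..., \<open>n\<close> determine the map: oddness gives the negative
  arguments, and everything outside the permuted set is fixed.\<close>

lemma bij_betw_word_of: "bij_betw (word_of n) (signed_perms n) (signed_words n)"
  unfolding bij_betw_def
proof
  let ?S = "{- int n..int n} - {0}"
  show "inj_on (word_of n) (signed_perms n)"
  proof (rule inj_onI, rule ext)
    fix \<sigma> \<tau> j
    assume \<sigma>: "\<sigma> \<in> signed_perms n" and \<tau>: "\<tau> \<in> signed_perms n" and eq: "word_of n \<sigma> = word_of n \<tau>"
    have odd: "\<sigma> (- k) = - \<sigma> k" "\<tau> (- k) = - \<tau> k" for k
      using \<sigma> \<tau> by (auto simp: signed_perms_def)
    have pos: "\<sigma> k = \<tau> k" if "1 \<le> k" "k \<le> int n" for k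
      using arg_cong[OF eq, of "\<lambda>w. w ! nat (k - 1)"] that by simp
    \<comment> \<open>The third case includes \<open>j = 0\<close>.\<close>
    consider "1 \<le> j" "j \<le> int n" | "1 \<le> - j" "- j \<le> int n" | "j \<notin> ?S"
      by force
    then show "\<sigma> j = \<tau> j"
    proof cases
      case 2
      then show ?thesis
        using pos[of "- j"] odd by simp
    next
      case 3
      then show ?thesis
        using \<sigma> \<tau> unfolding signed_perms_def by (metis (no_types, lifting) mem_Collect_eq permutes_not_in)
    qed (use pos in auto)
  qed
  show "word_of n ` signed_perms n = signed_words n"
  proof (intro equalityI subsetI)
    fix w assume "w \<in> word_of n ` signed_perms n"
    then obtain \<sigma> where \<sigma>: "\<sigma> \<in> signed_perms n" "w = word_of n \<sigma>"
      by auto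
    have "(\<lambda>v. nat \<bar>v\<bar>) ` set w = abs_perm \<sigma> ` {1..n}"
      by (simp add: \<sigma>(2) word_of_def abs_perm_def image_image atLeastLessThanSuc_atLeastAtMost del: upt_Suc)
    then show "w \<in> signed_words n"
      using signed_perms_abs_image[OF \<sigma>(1)] \<sigma>(2) by (simp add: signed_words_def)
  next
    fix w assume w: "w \<in> signed_words n"
    \<comment> \<open>The odd extension of \<open>w\<close>: the letter for position
      \<open>\<bar>j\<bar>\<close> sits at list index \<open>\<bar>j\<bar> - 1\<close>, and
      \<open>sgn\<close> supplies the oddness.\<close>
    define \<sigma> where "\<sigma> j = (if j \<in> ?S then sgn j * w ! nat (\<bar>j\<bar> - 1) else j)" for j
    have odd: "\<sigma> (- j) = - \<sigma> j" for j
      by (auto simp: \<sigma>_def sgn_if)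
    have len: "length w = n" and img: "(\<lambda>v. nat \<bar>v\<bar>) ` set w = {1..n}"
      using w by (auto simp: signed_words_def)
    \<comment> \<open>Covering \<open>?S\<close> is enough: the image has at most as many elements
      as the finite set \<open>?S\<close>, so counting yields both equality and injectivity.\<close>
    have "k \<in> \<sigma> ` ?S" if k: "k \<in> ?S" for k
    proof -
      have "nat \<bar>k\<bar> \<in> (\<lambda>v. nat \<bar>v\<bar>) ` set w"
        unfolding img using k by auto
      then obtain i where i: "i < n" "\<bar>w ! i\<bar> = \<bar>k\<bar>"
        using len by (auto simp: in_set_conv_nth)
      have s: "\<sigma> (int (Suc i)) = w ! i"
        using i by (simp add: \<sigma>_def)
      show ?thesis
      proof (cases "w ! i = k")
        case True
        then show ?thesis
          using s i by (intro image_eqI[where x = "int (Suc i)"]) auto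
      next
        case False
        then have "w ! i = - k"
          using i by linarith
        then show ?thesis
          using s i odd[of "int (Suc i)"] by (intro image_eqI[where x = "- int (Suc i)"]) auto
      qed
    qed
    then have sub: "?S \<subseteq> \<sigma> ` ?S"
      by blast
    have "card (\<sigma> ` ?S) \<le> card ?S"
      by (intro card_image_le) simp
    then have eq: "\<sigma> ` ?S = ?S"
      using sub by (metis card_seteq finite_Diff finite_atLeastAtMost_int finite_imageI)
    then have "bij_betw \<sigma> ?S ?S"
      by (simp add: bij_betw_def eq_card_imp_inj_on)
    then have "\<sigma> permutes ?S"
      by (rule bij_imp_permutes) (simp only: \<sigma>_def if_False)
    then have "\<sigma> \<in> signed_perms n"
      using odd by (simp add: signed_perms_def)
    moreover have "w = word_of n \<sigma>"
      using len by (intro nth_equalityI) (auto simp: \<sigma>_def)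
    ultimately show "w \<in> word_of n ` signed_perms n"
      by blast
  qed
qed

lemma word_fmaj_word_of:
  assumes "\<sigma> \<in> signed_perms n"
  shows "word_fmaj (word_of n \<sigma>) = fmaj n \<sigma>"
proof -
  \<comment> \<open>Oddness at 0 forces the value 0, so the 0 prepended in \<open>word_maj\<close>
    is the value of \<open>\<sigma>\<close> there.\<close>
  have "\<sigma> (- 0) = - \<sigma> 0"
    using assms unfolding signed_perms_def by blast
  then have zero: "\<sigma> 0 = 0"
    by simp
  have "(0 # word_of n \<sigma>) ! i = \<sigma> (int i)" if "i < n" for i
    using that zero by (cases i) auto
  then have "word_maj (word_of n \<sigma>) = (\<Sum>i<n. if \<sigma> (int i) > \<sigma> (int (Suc i)) then i else 0)"
    by (simp add: word_maj_def)
  also have "\<dots> = maj_A n \<sigma>"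
    unfolding maj_A_def Des_A_def
    by (subst sum.inter_filter) (auto simp: lessThan_atLeast0)
  finally have maj: "word_maj (word_of n \<sigma>) = maj_A n \<sigma>" .
  have "{i \<in> {1..n}. \<sigma> (int i) < 0} = Suc ` {i. i < n \<and> \<sigma> (int (Suc i)) < 0}"
  proof (intro equalityI subsetI)
    fix i assume "i \<in> {i \<in> {1..n}. \<sigma> (int i) < 0}"
    then show "i \<in> Suc ` {i. i < n \<and> \<sigma> (int (Suc i)) < 0}"
      by (cases i) auto
  qed auto
  then have "neg n \<sigma> = card {i. i < n \<and> \<sigma> (int (Suc i)) < 0}"
    by (simp add: neg_def card_image)
  also have "\<dots> = length (filter (\<lambda>v. v < 0) (word_of n \<sigma>))"
    by (auto simp: length_filter_conv_card intro!: arg_cong[where f = card])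
  finally show ?thesis
    using maj by (simp add: word_fmaj_def fmaj_def)
qed

text \<open>The products over values are pulled back to positions along
  \<open>abs_perm \<sigma>\<close>, which is injective on \<open>{1..n}\<close>; sorting the minimal
  positions by sign then yields a single product.\<close>

lemma min_weight_word_of:
  fixes x t :: "nat \<Rightarrow> 'a::comm_ring_1"
  assumes "\<sigma> \<in> signed_perms n"
  shows "min_weight x t (word_of n \<sigma>) = (\<Prod>i\<in>Min0 n \<sigma>. x i) * (\<Prod>i\<in>Min1 n \<sigma>. t i)"
proof -
  let ?R = "rl_min_positions n (abs_perm \<sigma>)"
  let ?g = "\<lambda>i. letter_weight x t (\<sigma> (int i))"
  have R: "?R \<subseteq> {1..n}"
    by (auto simp: rl_min_positions_def)
  have nonzero: "\<sigma> (int i) \<noteq> 0" if "i \<in> ?R" for i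
  proof -
    have "abs_perm \<sigma> i \<in> {1..n}"
      using that R signed_perms_abs_image[OF assms] by blast
    then show ?thesis by (auto simp: abs_perm_def)
  qed
  have Min0: "(\<Prod>i\<in>Min0 n \<sigma>. x i) = prod ?g {i \<in> ?R. \<sigma> (int i) > 0}"
  proof -
    have "Min0 n \<sigma> = abs_perm \<sigma> ` {i \<in> ?R. \<sigma> (int i) > 0}"
      by (auto simp: Min0_def)
    moreover have "inj_on (abs_perm \<sigma>) {i \<in> ?R. \<sigma> (int i) > 0}"
      using R by (intro inj_on_subset[OF inj_on_abs_perm[OF assms]]) auto
    ultimately show ?thesis
      by (simp add: prod.reindex) (simp add: letter_weight_def abs_perm_def)
  qed
  have Min1: "(\<Prod>i\<in>Min1 n \<sigma>. t i) = prod ?g {i \<in> ?R. \<sigma> (int i) < 0}"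
  proof -
    have "Min1 n \<sigma> = abs_perm \<sigma> ` {i \<in> ?R. \<sigma> (int i) < 0}"
      by (auto simp: Min1_def)
    moreover have "inj_on (abs_perm \<sigma>) {i \<in> ?R. \<sigma> (int i) < 0}"
      using R by (intro inj_on_subset[OF inj_on_abs_perm[OF assms]]) auto
    ultimately show ?thesis
      by (simp add: prod.reindex) (simp add: letter_weight_def abs_perm_def)
  qed
  have split: "?R = {i \<in> ?R. \<sigma> (int i) > 0} \<union> {i \<in> ?R. \<sigma> (int i) < 0}"
    using nonzero by force
  have "finite ?R"
    using R finite_subset by blast
  then have "prod ?g ?R = prod ?g {i \<in> ?R. \<sigma> (int i) > 0} * prod ?g {i \<in> ?R. \<sigma> (int i) < 0}"
    by (subst split, intro prod.union_disjoint) auto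
  then have rhs: "(\<Prod>i\<in>Min0 n \<sigma>. x i) * (\<Prod>i\<in>Min1 n \<sigma>. t i) = prod ?g ?R"
    using Min0 Min1 by simp
  \<comment> \<open>List index \<open>i\<close> is position \<open>Suc i\<close>, so the letters
    remaining after dropping \<open>Suc i\<close> of them are those in positions beyond
    \<open>Suc i\<close>.\<close>
  have later: "(\<forall>b\<in>set (drop (Suc i) (word_of n \<sigma>)). \<bar>\<sigma> (int (Suc i))\<bar> < \<bar>b\<bar>) \<longleftrightarrow> Suc i \<in> ?R"
    if "i < n" for i
  proof -
    have "set (drop (Suc i) (word_of n \<sigma>)) = (\<lambda>j. \<sigma> (int j)) ` {Suc i<..n}"
      by (simp add: word_of_def drop_map atLeastLessThanSuc_atLeastAtMost
          atLeastSucAtMost_greaterThanAtMost del: upt_Suc)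
    with that show ?thesis
      by (auto simp: rl_min_positions_def abs_perm_def)
  qed
  have "min_weight x t (word_of n \<sigma>) = (\<Prod>i<n. if Suc i \<in> ?R then ?g (Suc i) else 1)"
    unfolding min_weight_def length_word_of by (intro prod.cong) (simp_all only: later nth_word_of lessThan_iff)
  also have "\<dots> = (\<Prod>i\<in>{1..n}. if i \<in> ?R then ?g i else 1)"
    by (simp add: prod.atLeast1_atMost_eq)
  also have "\<dots> = prod ?g ?R"
    using R by (simp add: prod.inter_restrict[symmetric] Int_absorb1)
  finally show ?thesis
    using rhs by simp
qed

theorem theorem7p3:
  fixes n :: nat and x t :: "nat \<Rightarrow> 'a::comm_ring_1" and q :: 'a
  assumes "n \<ge> 1"
  shows "(\<Sum>\<sigma>\<in>signed_perms n. (\<Prod>i\<in>Min0 n \<sigma>. x i) * (\<Prod>i\<in>Min1 n \<sigma>. t i) * q ^ fmaj n \<sigma>)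
    = (\<Prod>j=1..n. x j + (\<Sum>k=1..2*j-2. q ^ k) + q ^ (2*j-1) * t j)"
proof -
  have "(\<Sum>\<sigma>\<in>signed_perms n. (\<Prod>i\<in>Min0 n \<sigma>. x i) * (\<Prod>i\<in>Min1 n \<sigma>. t i) * q ^ fmaj n \<sigma>)
      = (\<Sum>\<sigma>\<in>signed_perms n. min_weight x t (word_of n \<sigma>) * q ^ word_fmaj (word_of n \<sigma>))"
    by (intro sum.cong) (simp_all add: min_weight_word_of word_fmaj_word_of)
  also have "\<dots> = (\<Sum>w\<in>signed_words n. min_weight x t w * q ^ word_fmaj w)"
    by (rule sum.reindex_bij_betw[OF bij_betw_word_of])
  finally show ?thesis
    by (simp only: sum_signed_words)
qed

end
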